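(* Let $(K,v)$ be a valued field with valuation ring $\mathcal{O}_v$ and maximal ideal $\mathcal{M}_v$ of $\mathcal{O}_v$. Let $n\ge2$, $a\in\mathcal{O}_v$, and let $\mathcal{O}$ be a valuation ring of $K$ containing $\mathcal{O}_v$, with maximal ideal $\mathcal{M}$. Assume that $(a\mathcal{M})^n\ne a\mathcal{M}$. Then the following statements hold. 1) The annihilator of the $\mathcal{O}_v$-module $a\mathcal{M}/(a\mathcal{M})^n$ is $$\begin{cases}(a\mathcal{M})^{n-1}&\text{if }\mathcal{M}\text{ is a principal }\mathcal{O}\text{-ideal},\\(a\mathcal{O})^{n-1}=a^{n-1}\mathcal{O}&\text{if }\mathcal{M}\text{ is a nonprincipal }\mathcal{O}\text{-ideal}.\end{cases}$$ 2) This annihilator is equal to $\mathcal{M}_v$ if and only if $n=2$, $a\notin\mathcal{M}_v$ and $\mathcal{M}=\mathcal{M}_v$ is a principal $\mathcal{O}_v$-ideal.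
   Context: An $\mathcal{O}$-ideal is principal if it is of the form $b\mathcal{O}$ with $b\in K$, and nonprincipal otherwise. Products and powers of ideals are the usual ones (modules generated by products). *)

theory Defs
  imports "HOL-Algebra.Subrings" "HOL-Algebra.Ideal_Product" "HOL-Algebra.Module"
    "HOL-Library.Extended"
begin

text \<open>Krull valuations are written additively. They are allowed to map into an ordered abelian
  group that is larger than the value group.\<close>

locale valued_field = field K for K (structure) +
  fixes v :: "'a \<Rightarrow> 'g::linordered_ab_group_add extended"
  assumes v_not_Minf: "x \<in> carrier K \<Longrightarrow> v x \<noteq> -\<infinity>"
    and v_eq_infinity_iff: "x \<in> carrier K \<Longrightarrow> v x = \<infinity> \<longleftrightarrow> x = \<zero>"
    and v_mult: "\<lbrakk>x \<in> carrier K; y \<in> carrier K\<rbrakk> \<Longrightarrow> v (x \<otimes> y) = v x + v y"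
    and v_add: "\<lbrakk>x \<in> carrier K; y \<in> carrier K\<rbrakk> \<Longrightarrow> min (v x) (v y) \<le> v (x \<oplus> y)"

definition valuation_ring_of ::
    "('a, 'b) ring_scheme \<Rightarrow> ('a \<Rightarrow> 'g::linordered_ab_group_add extended) \<Rightarrow> 'a set"
  where "valuation_ring_of K v = {x \<in> carrier K. 0 \<le> v x}"

definition valuation_ring :: "'a set \<Rightarrow> ('a, 'b) ring_scheme \<Rightarrow> bool"
  where "valuation_ring A K \<longleftrightarrow>
    subring A K \<and> (\<forall>x \<in> carrier K - {\<zero>\<^bsub>K\<^esub>}. x \<in> A \<or> inv\<^bsub>K\<^esub> x \<in> A)"

text \<open>The generator ranges over all of \<open>K\<close>, so that the notion covers fractional ideals.\<close>

definition principal_in :: "('a, 'b) ring_scheme \<Rightarrow> 'a set \<Rightarrow> 'a set \<Rightarrow> bool"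
  where "principal_in K A I \<longleftrightarrow> (\<exists>b \<in> carrier K. I = b <#\<^bsub>K\<^esub> A)"

text \<open>The restriction of scalars of \<open>module_over_self K\<close> to a subring \<open>A\<close> has the same record, so
  an \<open>A\<close>-submodule \<open>N\<close> of \<open>K\<close> is \<open>(module_over_self K)\<lparr>carrier := N\<rparr>\<close>.\<close>

definition module_over_self :: "('a, 'b) ring_scheme \<Rightarrow> ('a, 'a) module"
  where "module_over_self K =
    \<lparr>carrier = carrier K, monoid.mult = monoid.mult K, one = one K, ring.zero = ring.zero K, add = add K,
     smult = monoid.mult K\<rparr>"

text \<open>The fields \<open>mult\<close> and \<open>one\<close> play no role in \<^locale>\<open>Module.module\<close>.\<close>

definition quotient_module :: "('r, 'a, 'c) module_scheme \<Rightarrow> 'a set \<Rightarrow> ('r, 'a set) module"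
  where "quotient_module N B =
    \<lparr>carrier = a_rcosets\<^bsub>N\<^esub> B, monoid.mult = undefined, one = undefined, ring.zero = B, add = set_add N,
     smult = (\<lambda>r C. \<Union>x\<in>C. B +>\<^bsub>N\<^esub> (r \<odot>\<^bsub>N\<^esub> x))\<rparr>"

lemma quotient_module_is_module:
  assumes N: "Module.module R N" and B: "submodule B R N"
  shows "Module.module R (quotient_module N B)"
proof -
  interpret N: Module.module R N by fact
  interpret S: submodule B R N by fact
  interpret G: abelian_subgroup B N
    by (intro abelian_subgroupI3 additive_subgroup.intro S.subgroup_axioms N.abelian_group_axioms)
  have smult: "r \<odot>\<^bsub>quotient_module N B\<^esub> (B +>\<^bsub>N\<^esub> x) = B +>\<^bsub>N\<^esub> (r \<odot>\<^bsub>N\<^esub> x)"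
    if r: "r \<in> carrier R" and x: "x \<in> carrier N" for r x
  proof -
    have const: "B +>\<^bsub>N\<^esub> (r \<odot>\<^bsub>N\<^esub> y) = B +>\<^bsub>N\<^esub> (r \<odot>\<^bsub>N\<^esub> x)" if y: "y \<in> B +>\<^bsub>N\<^esub> x" for y
    proof -
      obtain b where b: "b \<in> B" "y = b \<oplus>\<^bsub>N\<^esub> x" using y by (auto simp: a_r_coset_def')
      have "b \<in> carrier N" using b(1) by (rule G.a_Hcarr)
      then have "r \<odot>\<^bsub>N\<^esub> y = (r \<odot>\<^bsub>N\<^esub> b) \<oplus>\<^bsub>N\<^esub> (r \<odot>\<^bsub>N\<^esub> x)" using b r x by (simp add: N.smult_r_distr)
      moreover have "r \<odot>\<^bsub>N\<^esub> b \<in> B" using r b by simp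
      ultimately have "r \<odot>\<^bsub>N\<^esub> y \<in> B +>\<^bsub>N\<^esub> (r \<odot>\<^bsub>N\<^esub> x)" by (auto simp: a_r_coset_def')
      then show ?thesis using G.a_repr_independence'[of "r \<odot>\<^bsub>N\<^esub> y" "r \<odot>\<^bsub>N\<^esub> x"] r x by simp
    qed
    have "x \<in> B +>\<^bsub>N\<^esub> x" using x by (rule G.a_rcos_self)
    then have "(\<Union>y \<in> B +>\<^bsub>N\<^esub> x. B +>\<^bsub>N\<^esub> (r \<odot>\<^bsub>N\<^esub> y)) = B +>\<^bsub>N\<^esub> (r \<odot>\<^bsub>N\<^esub> x)"
      by (rule UN_constant_eq) (intro ballI const)
    then show ?thesis by (simp add: quotient_module_def)
  qed
  have add: "(B +>\<^bsub>N\<^esub> x) \<oplus>\<^bsub>quotient_module N B\<^esub> (B +>\<^bsub>N\<^esub> y) = B +>\<^bsub>N\<^esub> (x \<oplus>\<^bsub>N\<^esub> y)"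
    if "x \<in> carrier N" "y \<in> carrier N" for x y
    using that G.a_rcos_sum by (simp add: quotient_module_def)
  have car: "\<exists>x\<in>carrier N. C = B +>\<^bsub>N\<^esub> x" if "C \<in> carrier (quotient_module N B)" for C
    using that by (auto simp: quotient_module_def A_RCOSETS_def' a_r_coset_def')
  have carI: "B +>\<^bsub>N\<^esub> x \<in> carrier (quotient_module N B)" if "x \<in> carrier N" for x
    using that by (auto simp: quotient_module_def A_RCOSETS_def' a_r_coset_def')
  have cg: "comm_group (add_monoid (quotient_module N B))"
    using G.a_factorgroup_is_comm_group
    unfolding quotient_module_def A_FactGroup_def FactGroup_def A_RCOSETS_def set_add_def
      comm_group_def group_def comm_monoid_def monoid_def comm_monoid_axioms_def group_axioms_def
      Units_def
    unfolding partial_object.select_convs monoid.select_convs ring.select_convs by assumption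
  have ag: "abelian_group (quotient_module N B)"
    using cg by (intro abelian_group.intro abelian_monoid.intro abelian_group_axioms.intro)
      (simp_all add: comm_group.axioms)
  show ?thesis
  proof (intro moduleI N.R.is_cring ag)
    fix r C assume r: "r \<in> carrier R" and "C \<in> carrier (quotient_module N B)"
    then obtain x where x: "x \<in> carrier N" "C = B +>\<^bsub>N\<^esub> x" using car by blast
    show "r \<odot>\<^bsub>quotient_module N B\<^esub> C \<in> carrier (quotient_module N B)"
      using r x by (simp add: smult carI)
  next
    fix r s C assume rs: "r \<in> carrier R" "s \<in> carrier R"
      and "C \<in> carrier (quotient_module N B)"
    then obtain x where x: "x \<in> carrier N" "C = B +>\<^bsub>N\<^esub> x" using car by blast
    show "(r \<oplus>\<^bsub>R\<^esub> s) \<odot>\<^bsub>quotient_module N B\<^esub> C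
        = r \<odot>\<^bsub>quotient_module N B\<^esub> C \<oplus>\<^bsub>quotient_module N B\<^esub> s \<odot>\<^bsub>quotient_module N B\<^esub> C"
      using rs x by (simp add: smult add N.smult_l_distr)
    show "(r \<otimes>\<^bsub>R\<^esub> s) \<odot>\<^bsub>quotient_module N B\<^esub> C
        = r \<odot>\<^bsub>quotient_module N B\<^esub> (s \<odot>\<^bsub>quotient_module N B\<^esub> C)"
      using rs x by (simp add: smult N.smult_assoc1)
  next
    fix r C D assume r: "r \<in> carrier R"
      and "C \<in> carrier (quotient_module N B)" "D \<in> carrier (quotient_module N B)"
    then obtain x y where x: "x \<in> carrier N" "C = B +>\<^bsub>N\<^esub> x"
      and y: "y \<in> carrier N" "D = B +>\<^bsub>N\<^esub> y" using car by blast
    show "r \<odot>\<^bsub>quotient_module N B\<^esub> (C \<oplus>\<^bsub>quotient_module N B\<^esub> D)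
        = r \<odot>\<^bsub>quotient_module N B\<^esub> C \<oplus>\<^bsub>quotient_module N B\<^esub> r \<odot>\<^bsub>quotient_module N B\<^esub> D"
      using r x y by (simp add: smult add N.smult_r_distr)
  next
    fix C assume "C \<in> carrier (quotient_module N B)"
    then obtain x where x: "x \<in> carrier N" "C = B +>\<^bsub>N\<^esub> x" using car by blast
    show "\<one>\<^bsub>R\<^esub> \<odot>\<^bsub>quotient_module N B\<^esub> C = C"
      using x by (simp add: smult)
  qed
qed

definition annihilator ::
    "('r, 'b) ring_scheme \<Rightarrow> ('r, 'a, 'c) module_scheme \<Rightarrow> 'r set"
  where "annihilator R N = {r \<in> carrier R. \<forall>x \<in> carrier N. r \<odot>\<^bsub>N\<^esub> x = \<zero>\<^bsub>N\<^esub>}"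

end

theory Submission
  imports Defs
begin

text \<open>Principal factors come out of ideal powers: \<open>(cI)\<^sup>k = c\<^sup>k I\<^sup>k\<close>. If \<open>\<M> = b\<O>\<close>, then
  \<open>(a\<M>)\<^sup>n = (ab)\<^sup>n \<O>\<close>; if \<open>\<M>\<close> is not principal, then \<open>\<M>\<^sup>2 = \<M>\<close> and \<open>(a\<M>)\<^sup>n = a\<^sup>n \<M>\<close>, and
  \<open>(a\<M>)\<^sup>n \<noteq> a\<M>\<close> forces \<open>a \<in> \<M>\<close>. Since the multiplier ring of both \<open>\<O>\<close> and \<open>\<M>\<close> is \<open>\<O>\<close>, the
  annihilator is \<open>\<O>\<^sub>v \<inter> s\<O>\<close> with \<open>s = (ab)\<^sup>n\<^sup>-\<^sup>1\<close> or \<open>s = a\<^sup>n\<^sup>-\<^sup>1\<close>. Here \<open>s \<in> \<M>\<close> and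
  \<open>\<M> \<subseteq> \<M>\<^sub>v \<subseteq> \<O>\<^sub>v\<close>, so it is \<open>s\<O>\<close>. If this equals \<open>\<M>\<^sub>v\<close>, then \<open>s\<O> = \<M> = \<M>\<^sub>v\<close> and
  \<open>\<O> = \<O>\<^sub>v\<close>; so \<open>\<M>\<close> is principal, and comparing \<open>b\<O>\<close> with \<open>(ab)\<^sup>n\<^sup>-\<^sup>1 \<O>\<close> gives \<open>n = 2\<close> and \<open>a\<close> a unit.\<close>

section \<open>Products and powers of ideals under scaling\<close>

text \<open>\<open>ideal_prod\<close> consults only addition and multiplication, never the carrier.
  Products of \<open>\<O>\<close>-ideals can therefore be computed in \<open>K\<close>, where
  division is available.\<close>

lemma ideal_prod_carrier_update [simp]: "ideal_prod (R\<lparr>carrier := A\<rparr>) I J = ideal_prod R I J"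
proof (intro equalityI subsetI)
  fix x assume "x \<in> ideal_prod (R\<lparr>carrier := A\<rparr>) I J"
  then show "x \<in> ideal_prod R I J"
    by induction (auto intro: ideal_prod.intros)
next
  fix x assume "x \<in> ideal_prod R I J"
  then show "x \<in> ideal_prod (R\<lparr>carrier := A\<rparr>) I J"
  proof induction
    case (prod i j)
    then show ?case using ideal_prod.prod[of i I j J "R\<lparr>carrier := A\<rparr>"] by simp
  next
    case (sum s t)
    then show ?case using ideal_prod.sum[of s "R\<lparr>carrier := A\<rparr>" I J t] by simp
  qed
qed

lemma ideals_set_pow_0: "I [^]\<^bsub>ideals_set R\<^esub> (0::nat) = carrier R"
  by (simp add: nat_pow_def ideals_set_def)

lemma ideals_set_pow_Suc:
  "I [^]\<^bsub>ideals_set R\<^esub> Suc k = ideal_prod R (I [^]\<^bsub>ideals_set R\<^esub> k) I"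
  by (simp add: nat_pow_def ideals_set_def)

lemma (in monoid) l_coset_l_coset:
  assumes "I \<subseteq> carrier G" "x \<in> carrier G" "y \<in> carrier G"
  shows "x <# (y <# I) = (x \<otimes> y) <# I"
  using assms by (force simp: l_coset_def m_assoc)

lemma (in cring) ideal_prod_closed:
  assumes "I \<subseteq> carrier R" "J \<subseteq> carrier R"
  shows "ideal_prod R I J \<subseteq> carrier R"
proof
  fix x assume "x \<in> ideal_prod R I J"
  then show "x \<in> carrier R" using assms by induction auto
qed

text \<open>Both inclusions follow by induction on the generation of the product. Arbitrary subsets
  are allowed so that, with \<open>R\<close> a field, \<open>I\<close> and \<open>J\<close> may be
  ideals of a subring and the scalars any field elements.\<close>

lemma (in cring) ideal_prod_l_coset:
  assumes c: "c \<in> carrier R" and d: "d \<in> carrier R"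
    and I: "I \<subseteq> carrier R" and J: "J \<subseteq> carrier R"
  shows "ideal_prod R (c <# I) (d <# J) = (c \<otimes> d) <# ideal_prod R I J"
proof (intro equalityI subsetI)
  note IJ = subsetD[OF ideal_prod_closed[OF I J]]
  fix x assume "x \<in> ideal_prod R (c <# I) (d <# J)"
  then show "x \<in> (c \<otimes> d) <# ideal_prod R I J"
  proof induction
    case (prod p q)
    then obtain i j where ij: "i \<in> I" "p = c \<otimes> i" "j \<in> J" "q = d \<otimes> j"
      by (auto simp: l_coset_def)
    then have "p \<otimes> q = (c \<otimes> d) \<otimes> (i \<otimes> j)"
      using c d I J by (simp add: m_ac subset_iff)
    then show ?case using ij by (auto simp: l_coset_def intro: ideal_prod.prod)
  next
    case (sum s t)
    then obtain s' t' where st: "s' \<in> ideal_prod R I J" "s = (c \<otimes> d) \<otimes> s'"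
      "t' \<in> ideal_prod R I J" "t = (c \<otimes> d) \<otimes> t'"
      by (auto simp: l_coset_def)
    then have "s \<oplus> t = (c \<otimes> d) \<otimes> (s' \<oplus> t')"
      using c d IJ by (simp add: r_distr)
    then show ?case using st by (auto simp: l_coset_def intro: ideal_prod.sum)
  qed
next
  note IJ = subsetD[OF ideal_prod_closed[OF I J]]
  fix x assume "x \<in> (c \<otimes> d) <# ideal_prod R I J"
  then obtain y where y: "y \<in> ideal_prod R I J" and x: "x = (c \<otimes> d) \<otimes> y"
    by (auto simp: l_coset_def)
  from y have "(c \<otimes> d) \<otimes> y \<in> ideal_prod R (c <# I) (d <# J)"
  proof induction
    case (prod i j)
    have "(c \<otimes> d) \<otimes> (i \<otimes> j) = (c \<otimes> i) \<otimes> (d \<otimes> j)"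
      using prod c d I J by (simp add: m_ac subset_iff)
    moreover have "c \<otimes> i \<in> c <# I" "d \<otimes> j \<in> d <# J"
      using prod by (auto simp: l_coset_def)
    ultimately show ?case by (simp add: ideal_prod.prod)
  next
    case (sum s t)
    then show ?case using c d IJ by (simp add: r_distr ideal_prod.sum)
  qed
  then show "x \<in> ideal_prod R (c <# I) (d <# J)" using x by simp
qed

lemma (in cring) ideal_l_coset:
  assumes I: "ideal I R" and c: "c \<in> carrier R"
  shows "ideal (c <# I) R"
proof -
  interpret I: ideal I R by fact
  show ?thesis
  proof (rule idealI)
    show "ring R" by (rule ring_axioms)
    show "subgroup (c <# I) (add_monoid R)"
    proof (rule add.subgroupI)
      show "c <# I \<subseteq> carrier R" using c by (auto simp: l_coset_def)
      show "c <# I \<noteq> {}"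
        using additive_subgroup.zero_closed[OF I.additive_subgroup_axioms]
        unfolding l_coset_def by blast
    next
      fix x assume "x \<in> c <# I"
      then obtain i where i: "i \<in> I" "x = c \<otimes> i" by (auto simp: l_coset_def)
      then have "\<ominus> x = c \<otimes> (\<ominus> i)" using c by (simp add: r_minus)
      then show "\<ominus> x \<in> c <# I" using i by (auto simp: l_coset_def)
    next
      fix x y assume "x \<in> c <# I" "y \<in> c <# I"
      then obtain i j where ij: "i \<in> I" "x = c \<otimes> i" "j \<in> I" "y = c \<otimes> j"
        by (auto simp: l_coset_def)
      then have "x \<oplus> y = c \<otimes> (i \<oplus> j)" using c by (simp add: r_distr)
      then show "x \<oplus> y \<in> c <# I" using ij by (auto simp: l_coset_def)
    qed
  next
    fix x r assume "x \<in> c <# I" and r: "r \<in> carrier R"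
    then obtain i where i: "i \<in> I" "x = c \<otimes> i" by (auto simp: l_coset_def)
    then have "r \<otimes> x = c \<otimes> (r \<otimes> i)" "x \<otimes> r = c \<otimes> (r \<otimes> i)"
      using c r by (simp_all add: m_ac)
    then show "r \<otimes> x \<in> c <# I" "x \<otimes> r \<in> c <# I"
      using i r by (auto simp: l_coset_def I.I_l_closed)
  qed
qed

lemma (in cring) ideals_set_pow_closed:
  assumes "ideal I R"
  shows "ideal (I [^]\<^bsub>ideals_set R\<^esub> (k::nat)) R"
proof (induction k)
  case 0
  show ?case unfolding ideals_set_pow_0 by (rule oneideal)
next
  case (Suc k)
  then show ?case unfolding ideals_set_pow_Suc using assms by (rule ideal_prod_is_ideal)
qed

section \<open>Division in a field\<close>

lemma (in field) mem_l_coset_iff: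
  assumes "c \<in> carrier R" "c \<noteq> \<zero>" "I \<subseteq> carrier R"
  shows "x \<in> c <# I \<longleftrightarrow> x \<in> carrier R \<and> inv c \<otimes> x \<in> I"
proof -
  have u: "c \<in> Units R" using assms by (simp add: field_Units)
  have "x = c \<otimes> (inv c \<otimes> x)" if "x \<in> carrier R"
    using u that assms by (simp add: m_assoc[symmetric])
  moreover have "inv c \<otimes> (c \<otimes> h) = h" if "h \<in> I" for h
    using u that assms by (simp add: m_assoc[symmetric] subset_iff)
  ultimately show ?thesis using assms by (auto simp: l_coset_def)
qed

lemma (in field) nonzero_inv_facts:
  assumes "x \<in> carrier R" "x \<noteq> \<zero>"
  shows "inv x \<in> carrier R" "inv x \<noteq> \<zero>" "inv (inv x) = x" "x \<otimes> inv x = \<one>" "inv x \<otimes> x = \<one>"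
proof -
  have u: "x \<in> Units R" using assms by (simp add: field_Units)
  then show "inv x \<in> carrier R" "inv (inv x) = x" "x \<otimes> inv x = \<one>" "inv x \<otimes> x = \<one>"
    by simp_all
  then show "inv x \<noteq> \<zero>" using assms by auto
qed

lemma (in domain) nonzero_pow:
  assumes "x \<in> carrier R" "x \<noteq> \<zero>"
  shows "x [^] (k::nat) \<noteq> \<zero>"
  using assms integral by (induction k) auto

lemma (in field) inv_mult_inv:
  assumes x: "x \<in> carrier R" "x \<noteq> \<zero>" and y: "y \<in> carrier R" "y \<noteq> \<zero>"
  shows "inv (inv x \<otimes> y) = inv y \<otimes> x"
proof (rule comm_inv_char)
  note xi = nonzero_inv_facts[OF x] and yi = nonzero_inv_facts[OF y]
  show "inv x \<otimes> y \<in> carrier R" "inv y \<otimes> x \<in> carrier R" using xi yi x y by simp_all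
  have "(inv x \<otimes> y) \<otimes> (inv y \<otimes> x) = inv x \<otimes> ((y \<otimes> inv y) \<otimes> x)"
    using xi(1) yi(1) x(1) y(1) by (simp add: m_assoc)
  then show "(inv x \<otimes> y) \<otimes> (inv y \<otimes> x) = \<one>" using xi yi x by simp
qed

section \<open>Annihilators of quotients as colon ideals\<close>

text \<open>A scalar kills the coset of \<open>x\<close> exactly when it moves \<open>x\<close> into
  \<open>B\<close>. Two rings occur because the scalars come from \<open>A\<close> while
  \<open>B\<close> is an ideal of the larger ring \<open>C\<close>.\<close>

lemma (in cring) annihilator_quotient_eq:
  assumes A: "subring A R" and C: "subring C R" and AC: "A \<subseteq> C"
    and N: "N \<subseteq> carrier R" and B: "ideal B (R\<lparr>carrier := C\<rparr>)"
  shows "annihilator (R\<lparr>carrier := A\<rparr>) (quotient_module ((module_over_self R)\<lparr>carrier := N\<rparr>) B)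
    = {r \<in> A. \<forall>x \<in> N. r \<otimes> x \<in> B}"
proof -
  let ?N = "(module_over_self R)\<lparr>carrier := N\<rparr>"
  interpret B: ideal B "R\<lparr>carrier := C\<rparr>" by fact
  have CR: "C \<subseteq> carrier R" and AR: "A \<subseteq> carrier R" using A C subringE by blast+
  have BC: "B \<subseteq> C" using B.a_subset by simp
  have zB: "\<zero> \<in> B" using additive_subgroup.zero_closed[OF B.additive_subgroup_axioms] by simp
  have aB: "x \<oplus> y \<in> B" if "x \<in> B" "y \<in> B" for x y using additive_subgroup.a_closed[OF B.additive_subgroup_axioms] that by simp
  have mB: "r \<otimes> x \<in> B" if "x \<in> B" "r \<in> C" for r x using B.I_l_closed that by simp
  have cos: "B +>\<^bsub>?N\<^esub> y = {b \<oplus> y | b. b \<in> B}" for y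
    by (auto simp: a_r_coset_def' module_over_self_def)
  have self: "B +>\<^bsub>?N\<^esub> y = B" if y: "y \<in> B" for y
  proof (intro equalityI subsetI)
    fix x assume "x \<in> B +>\<^bsub>?N\<^esub> y"
    then show "x \<in> B" using aB y by (auto simp: cos)
  next
    fix x assume x: "x \<in> B"
    \<comment> \<open>Additive inverses depend on the carrier of the record, so subtraction of
      \<open>y\<close> is done by multiplying with the \<open>\<ominus> \<one>\<close> of
      \<open>R\<close>, which lies in \<open>C\<close>.\<close>
    have "\<ominus> \<one> \<in> C" using subringE(3,5)[OF C] by blast
    then have "x \<oplus> (\<ominus> \<one> \<otimes> y) \<in> B" using x y aB mB by blast
    moreover have "x = (x \<oplus> (\<ominus> \<one> \<otimes> y)) \<oplus> y"
      using x y BC CR by (simp add: subset_iff l_minus a_assoc l_neg)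
    ultimately show "x \<in> B +>\<^bsub>?N\<^esub> y" by (auto simp: cos)
  qed
  have "(\<Union>y \<in> B +>\<^bsub>?N\<^esub> x. B +>\<^bsub>?N\<^esub> (r \<otimes> y)) = B \<longleftrightarrow> r \<otimes> x \<in> B"
    if r: "r \<in> A" and x: "x \<in> N" for r x
  proof
    have xR: "x \<in> carrier R" and rR: "r \<in> carrier R" using x r N AR by auto
    have "x \<in> B +>\<^bsub>?N\<^esub> x" using zB xR by (force simp: cos)
    moreover have "r \<otimes> x \<in> B +>\<^bsub>?N\<^esub> (r \<otimes> x)" using zB xR rR by (force simp: cos)
    ultimately show "r \<otimes> x \<in> B" if "(\<Union>y \<in> B +>\<^bsub>?N\<^esub> x. B +>\<^bsub>?N\<^esub> (r \<otimes> y)) = B"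
      using that by blast
    assume rx: "r \<otimes> x \<in> B"
    \<comment> \<open>The scalar action on cosets is a union; here every set in that union is
      \<open>B\<close> itself.\<close>
    have "B +>\<^bsub>?N\<^esub> (r \<otimes> y) = B" if "y \<in> B +>\<^bsub>?N\<^esub> x" for y
    proof -
      obtain b where b: "b \<in> B" "y = b \<oplus> x" using \<open>y \<in> _\<close> by (auto simp: cos)
      have "r \<otimes> y = r \<otimes> b \<oplus> r \<otimes> x" using b xR rR BC CR by (simp add: r_distr subset_iff)
      then show ?thesis using b r rx AC aB mB self by (simp add: subset_iff)
    qed
    with \<open>x \<in> B +>\<^bsub>?N\<^esub> x\<close> show "(\<Union>y \<in> B +>\<^bsub>?N\<^esub> x. B +>\<^bsub>?N\<^esub> (r \<otimes> y)) = B"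
      by blast
  qed
  moreover have "smult ?N = (\<otimes>)" by (simp add: module_over_self_def)
  then have "r \<odot>\<^bsub>quotient_module ?N B\<^esub> C = (\<Union>y \<in> C. B +>\<^bsub>?N\<^esub> (r \<otimes> y))" for r C
    by (simp add: quotient_module_def)
  moreover have "\<zero>\<^bsub>quotient_module ?N B\<^esub> = B" by (simp add: quotient_module_def)
  moreover have "carrier (quotient_module ?N B) = (\<lambda>x. B +>\<^bsub>?N\<^esub> x) ` N"
    by (auto simp: quotient_module_def A_RCOSETS_def' a_r_coset_def' module_over_self_def)
  ultimately show ?thesis
    by (simp add: annihilator_def cong: conj_cong)
qed

section \<open>The valuation ring of a valuation\<close>

lemma (in valued_field) v_one: "v \<one> = 0"
  using v_mult[of \<one> \<one>] v_not_Minf[of \<one>] v_eq_infinity_iff[of \<one>]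
  by (cases "v \<one>") (auto simp: zero_extended_def)

text \<open>Twice this value is \<open>v \<one> = 0\<close>, and a linearly ordered group has no
  torsion. It makes the valuation ring closed under negation.\<close>

lemma (in valued_field) v_minus_one: "v (\<ominus> \<one>) = 0"
proof -
  have "v (\<ominus> \<one>) + v (\<ominus> \<one>) = v (\<ominus> \<one> \<otimes> \<ominus> \<one>)"
    using v_mult[of "\<ominus> \<one>" "\<ominus> \<one>"] by (simp only: a_inv_closed one_closed)
  then have "v (\<ominus> \<one>) + v (\<ominus> \<one>) = 0" using v_one by (simp add: l_minus)
  then show ?thesis by (cases "v (\<ominus> \<one>)") (auto simp: zero_extended_def)
qed

lemma (in valued_field) valuation_ring_valuation_ring_of:
  "valuation_ring (valuation_ring_of K v) K"
  unfolding valuation_ring_def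
proof
  have pos: "0 \<le> x + y" if "0 \<le> x" "0 \<le> y" for x y :: "'g extended"
    using add_mono[OF that] by simp
  show "subring (valuation_ring_of K v) K"
  proof (rule subringI)
    fix x assume x: "x \<in> valuation_ring_of K v"
    then have "v (\<ominus> x) = v (\<ominus> \<one>) + v x"
      using v_mult[of "\<ominus> \<one>" x] by (simp add: valuation_ring_of_def l_minus)
    then show "\<ominus> x \<in> valuation_ring_of K v"
      using x by (simp add: valuation_ring_of_def v_minus_one)
  next
    fix x y assume "x \<in> valuation_ring_of K v" "y \<in> valuation_ring_of K v"
    then show "x \<otimes> y \<in> valuation_ring_of K v" "x \<oplus> y \<in> valuation_ring_of K v"
      using v_add[of x y] by (auto simp: valuation_ring_of_def v_mult pos min_def split: if_splits)
  qed (auto simp: valuation_ring_of_def v_one)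
  show "\<forall>x \<in> carrier K - {\<zero>}. x \<in> valuation_ring_of K v \<or> inv x \<in> valuation_ring_of K v"
  proof
    fix x assume x: "x \<in> carrier K - {\<zero>}"
    have "v x + v (inv x) = 0"
      using v_mult[of x "inv x"] nonzero_inv_facts[of x] x v_one by simp
    then have "0 \<le> v x \<or> 0 \<le> v (inv x)"
      by (cases "v x"; cases "v (inv x)") (auto simp: zero_extended_def add_eq_0_iff)
    then show "x \<in> valuation_ring_of K v \<or> inv x \<in> valuation_ring_of K v"
      using x nonzero_inv_facts[of x] by (auto simp: valuation_ring_of_def)
  qed
qed

section \<open>Valuation rings and their maximal ideals\<close>

text \<open>Serves both pairs \<open>\<O>\<^sub>v\<close>, \<open>\<M>\<^sub>v\<close> and
  \<open>\<O>\<close>, \<open>\<M>\<close>. Locality is not assumed: it is derived in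
  \<open>not_mem_M_inv\<close>.\<close>

locale local_valuation_ring = field R for R (structure) +
  fixes A M
  assumes valuation_ring: "valuation_ring A R"
    and maximalideal: "maximalideal M (R\<lparr>carrier := A\<rparr>)"
begin

lemma subring: "subring A R"
  using valuation_ring by (simp add: valuation_ring_def)

lemma cring_A: "cring (R\<lparr>carrier := A\<rparr>)"
  using subring_is_domain[OF subring] by (rule domain.axioms)

lemma ideal_M: "ideal M (R\<lparr>carrier := A\<rparr>)"
  using maximalideal by (rule maximalideal.axioms)

lemma A_subset: "A \<subseteq> carrier R"
  by (rule subringE(1)[OF subring])

lemma one_mem_A: "\<one> \<in> A"
  by (rule subringE(3)[OF subring])

lemma M_subset_A: "M \<subseteq> A"
  using ideal.Icarr[OF ideal_M] by auto

lemma zero_mem_M: "\<zero> \<in> M"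
  using additive_subgroup.zero_closed[OF ideal.axioms(1)[OF ideal_M]] by simp

lemma mult_mem_M:
  assumes "x \<in> M" "y \<in> A"
  shows "x \<otimes> y \<in> M" "y \<otimes> x \<in> M"
  using ideal.I_r_closed[OF ideal_M] ideal.I_l_closed[OF ideal_M] assms by auto

lemma l_coset_subset_M:
  assumes "x \<in> M"
  shows "x <# A \<subseteq> M"
  using assms mult_mem_M(1) by (auto simp: l_coset_def)

lemma one_not_mem_M: "\<one> \<notin> M"
proof
  assume "\<one> \<in> M"
  then have "A \<subseteq> M" using mult_mem_M(2)[of \<one>] A_subset by fastforce
  then show False using M_subset_A maximalideal.I_notcarr[OF maximalideal] by auto
qed

text \<open>By maximality \<open>M + xA = A\<close>, so \<open>1 = u + wx\<close> with
  \<open>u\<close> in \<open>M\<close>. If \<open>1/x\<close> were outside \<open>A\<close>, then so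
  would be \<open>u/x = 1/x - w\<close>; its inverse \<open>x/u\<close> would lie in
  \<open>A\<close>, and \<open>x = u(x/u)\<close> would lie in \<open>M\<close>.\<close>

lemma not_mem_M_inv:
  assumes x: "x \<in> A" "x \<notin> M"
  shows "inv x \<in> A"
proof -
  let ?A = "R\<lparr>carrier := A\<rparr>"
  interpret A: cring ?A by (rule cring_A)
  interpret P: ideal "PIdl\<^bsub>?A\<^esub> x" ?A using x by (simp add: A.cgenideal_ideal)
  have J: "ideal (M <+>\<^bsub>?A\<^esub> PIdl\<^bsub>?A\<^esub> x) ?A"
    by (rule A.add_ideals[OF ideal_M P.is_ideal])
  have mem: "y \<in> M <+>\<^bsub>?A\<^esub> PIdl\<^bsub>?A\<^esub> x \<longleftrightarrow> (\<exists>u\<in>M. \<exists>w\<in>A. y = u \<oplus> w \<otimes> x)" for y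
    by (auto simp: set_add_def' cgenideal_def)
  have xc: "x \<in> carrier R" and x0: "x \<noteq> \<zero>" using x A_subset zero_mem_M by auto
  have "\<zero> \<in> A" "\<And>u. u \<in> M \<Longrightarrow> u = u \<oplus> \<zero> \<otimes> x"
    using M_subset_A zero_mem_M A_subset xc by auto
  then have "M \<subseteq> M <+>\<^bsub>?A\<^esub> PIdl\<^bsub>?A\<^esub> x" using mem by blast
  moreover have "x = \<zero> \<oplus> \<one> \<otimes> x" using xc by simp
  then have "x \<in> M <+>\<^bsub>?A\<^esub> PIdl\<^bsub>?A\<^esub> x" using mem zero_mem_M one_mem_A by blast
  ultimately have "M <+>\<^bsub>?A\<^esub> PIdl\<^bsub>?A\<^esub> x = A"
    using maximalideal.I_maximal[OF maximalideal J] ideal.Icarr[OF J] x by auto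
  then obtain u w where uw: "u \<in> M" "w \<in> A" "\<one> = u \<oplus> w \<otimes> x"
    using mem one_mem_A by metis
  note xi = nonzero_inv_facts[OF xc x0]
  have uc: "u \<in> carrier R" and wc: "w \<in> carrier R" using uw M_subset_A A_subset by auto
  show ?thesis
  proof (rule ccontr)
    assume ni: "inv x \<notin> A"
    have "inv x = inv x \<otimes> (u \<oplus> w \<otimes> x)" using xi uw(3)[symmetric] by simp
    also have "\<dots> = inv x \<otimes> u \<oplus> w" using xi xc uc wc by (simp add: r_distr m_lcomm)
    finally have "inv x \<otimes> u \<notin> A" using ni uw(2) subringE(7)[OF subring] by metis
    moreover have u0: "u \<noteq> \<zero>"
      using calculation xi M_subset_A zero_mem_M by auto
    moreover note ui = nonzero_inv_facts[OF uc u0]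
    have "inv (inv x \<otimes> u) = inv u \<otimes> x"
      by (rule inv_mult_inv[OF xc x0 uc u0])
    ultimately have "inv u \<otimes> x \<in> A"
      using valuation_ring xi uc integral[of "inv x" u] by (auto simp: valuation_ring_def)
    then have "u \<otimes> (inv u \<otimes> x) \<in> M" using uw mult_mem_M by blast
    then show False using ui xc uc x by (simp add: m_assoc[symmetric])
  qed
qed

text \<open>The inverse lies in \<open>A\<close> by the valuation property. Outside \<open>M\<close>
  it would be a unit of \<open>A\<close>, putting \<open>x\<close> back into
  \<open>A\<close>.\<close>

lemma not_mem_A_inv:
  assumes x: "x \<in> carrier R" "x \<notin> A"
  shows "x \<noteq> \<zero>" "inv x \<in> M"
proof -
  show x0: "x \<noteq> \<zero>" using x zero_mem_M M_subset_A by auto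
  then have "inv x \<in> A" using x valuation_ring by (auto simp: valuation_ring_def)
  then show "inv x \<in> M" using not_mem_M_inv[of "inv x"] nonzero_inv_facts[OF x(1) x0] x by metis
qed

text \<open>An element of \<open>M\<close> outside \<open>N\<close> has its inverse in
  \<open>B\<close>, hence in \<open>A\<close>, which would put \<open>1\<close> into
  \<open>M\<close>.\<close>

lemma maximal_ideal_antimono:
  assumes "local_valuation_ring R B N" "B \<subseteq> A"
  shows "M \<subseteq> N"
proof
  interpret B: local_valuation_ring R B N by fact
  fix x assume x: "x \<in> M"
  then have xc: "x \<in> carrier R" using M_subset_A A_subset by auto
  show "x \<in> N"
  proof (rule ccontr)
    assume n: "x \<notin> N"
    then have x0: "x \<noteq> \<zero>" using B.zero_mem_M by auto
    have "inv x \<in> B"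
      using n xc B.not_mem_M_inv B.not_mem_A_inv(2) B.M_subset_A by (cases "x \<in> B") auto
    then have "x \<otimes> inv x \<in> M" using assms(2) x mult_mem_M by blast
    then show False using nonzero_inv_facts[OF xc x0] one_not_mem_M by simp
  qed
qed

text \<open>An element of \<open>A\<close> outside \<open>B\<close> has its inverse in the common
  ideal \<open>M\<close>. As \<open>M\<close> absorbs \<open>A\<close>, it would contain
  \<open>1\<close>.\<close>

lemma ring_eq_of_maximal_ideal_eq:
  assumes "local_valuation_ring R B M" "B \<subseteq> A"
  shows "B = A"
proof (rule ccontr)
  interpret B: local_valuation_ring R B M by fact
  assume "B \<noteq> A"
  then obtain x where x: "x \<in> A" "x \<notin> B" using assms(2) by blast
  then have xc: "x \<in> carrier R" using A_subset by auto
  have "inv x \<otimes> x \<in> M" using mult_mem_M(1) B.not_mem_A_inv(2)[OF xc x(2)] x(1) by blast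
  moreover have "inv x \<otimes> x = \<one>" using nonzero_inv_facts[OF xc] B.not_mem_A_inv(1)[OF xc x(2)] by blast
  ultimately show False using one_not_mem_M by simp
qed

lemma l_coset_unit:
  assumes I: "ideal I (R\<lparr>carrier := A\<rparr>)" and c: "c \<in> A" "c \<notin> M"
  shows "c <# I = I"
proof -
  interpret I: ideal I "R\<lparr>carrier := A\<rparr>" by fact
  have cc: "c \<in> carrier R" "c \<noteq> \<zero>" using c A_subset zero_mem_M by auto
  note ci = nonzero_inv_facts[OF cc]
  have Ic: "I \<subseteq> carrier R" using I.a_subset A_subset by auto
  have "x \<in> c <# I \<longleftrightarrow> x \<in> I" for x
  proof -
    have "inv c \<otimes> x \<in> I" if "x \<in> I" using that not_mem_M_inv[OF c] I.I_l_closed by simp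
    moreover have "x \<in> I" if "inv c \<otimes> x \<in> I" "x \<in> carrier R"
      using that I.I_l_closed[of "inv c \<otimes> x" c] c ci cc by (simp add: m_assoc[symmetric])
    ultimately show ?thesis using mem_l_coset_iff[OF cc Ic] Ic by blast
  qed
  then show ?thesis by blast
qed

section \<open>Powers and multipliers of the maximal ideal\<close>

text \<open>For \<open>x\<close> in \<open>M\<close>, nonprincipality gives \<open>y\<close> in
  \<open>M\<close> outside \<open>xA\<close>. Then \<open>y/x\<close> is not in \<open>A\<close>, so
  \<open>x/y\<close> is in \<open>M\<close>, and \<open>x = y(x/y)\<close> is a product of two
  elements of \<open>M\<close>.\<close>

lemma nonprincipal_idempotent:
  assumes np: "\<not> principal_in R A M"
  shows "ideal_prod R M M = M"
proof (intro equalityI subsetI)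
  interpret A: cring "R\<lparr>carrier := A\<rparr>" by (rule cring_A)
  fix x assume "x \<in> ideal_prod R M M"
  then show "x \<in> M" using A.ideal_prod_inter[OF ideal_M ideal_M] by auto
next
  fix x assume x: "x \<in> M"
  then have xc: "x \<in> carrier R" using M_subset_A A_subset by auto
  with np xc l_coset_subset_M[OF x] obtain y where y: "y \<in> M" "y \<notin> x <# A" by (auto simp: principal_in_def)
  then have yc: "y \<in> carrier R" using M_subset_A A_subset by auto
  show "x \<in> ideal_prod R M M"
  proof (cases "x = \<zero>")
    case True
    then show ?thesis using ideal_prod.prod[OF zero_mem_M zero_mem_M, of R] by simp
  next
    case False
    note xi = nonzero_inv_facts[OF xc False]
    have "\<zero> \<in> x <# A" using zero_mem_M M_subset_A xc by (force simp: l_coset_def)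
    then have y0: "y \<noteq> \<zero>" using y by auto
    note yi = nonzero_inv_facts[OF yc y0]
    have "inv x \<otimes> y \<notin> A" using y yc mem_l_coset_iff[OF xc False A_subset] by blast
    then have "inv (inv x \<otimes> y) \<in> M" using xi yc by (intro not_mem_A_inv) auto
    moreover have "inv (inv x \<otimes> y) = inv y \<otimes> x"
      by (rule inv_mult_inv[OF xc False yc y0])
    ultimately have "y \<otimes> (inv y \<otimes> x) \<in> ideal_prod R M M" using y by (auto intro: ideal_prod.prod)
    then show ?thesis using yi yc xc by (simp add: m_assoc[symmetric])
  qed
qed

lemma pow_l_coset:
  assumes I: "ideal I (R\<lparr>carrier := A\<rparr>)" and c: "c \<in> carrier R"
  shows "(c <# I) [^]\<^bsub>ideals_set (R\<lparr>carrier := A\<rparr>)\<^esub> (k::nat)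
    = (c [^] k) <# (I [^]\<^bsub>ideals_set (R\<lparr>carrier := A\<rparr>)\<^esub> k)"
proof (induction k)
  case 0
  show ?case unfolding ideals_set_pow_0 using A_subset by (force simp: l_coset_def)
next
  case (Suc k)
  interpret A: cring "R\<lparr>carrier := A\<rparr>" by (rule cring_A)
  have sub: "J \<subseteq> carrier R" if "ideal J (R\<lparr>carrier := A\<rparr>)" for J
    using ideal.Icarr[OF that] A_subset by auto
  show ?case
    using Suc ideal_prod_l_coset[OF nat_pow_closed[OF c] c sub[OF A.ideals_set_pow_closed[OF I]] sub[OF I]]
    unfolding ideals_set_pow_Suc by simp
qed

lemma A_pow: "A [^]\<^bsub>ideals_set (R\<lparr>carrier := A\<rparr>)\<^esub> (k::nat) = A"
proof (induction k)
  case 0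
  show ?case unfolding ideals_set_pow_0 by simp
next
  case (Suc k)
  interpret A: cring "R\<lparr>carrier := A\<rparr>" by (rule cring_A)
  show ?case unfolding ideals_set_pow_Suc using Suc A.ideal_prod_one[OF A.oneideal] by simp
qed

text \<open>Iterated idempotence. The exponent must be positive because the zeroth power is
  \<open>A\<close>.\<close>

lemma M_pow_nonprincipal:
  assumes "\<not> principal_in R A M" "0 < (k::nat)"
  shows "M [^]\<^bsub>ideals_set (R\<lparr>carrier := A\<rparr>)\<^esub> k = M"
  using assms(2)
proof (induction k)
  case (Suc k)
  interpret A: cring "R\<lparr>carrier := A\<rparr>" by (rule cring_A)
  have "ideal_prod (R\<lparr>carrier := A\<rparr>) A M = M"
    using A.ideal_prod_one[OF ideal_M] A.ideal_prod_commute[OF ideal_M A.oneideal] by simp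
  moreover have "M [^]\<^bsub>ideals_set (R\<lparr>carrier := A\<rparr>)\<^esub> k = (if k = 0 then A else M)"
    using Suc ideals_set_pow_0[where I = M and R = "R\<lparr>carrier := A\<rparr>"] by simp
  ultimately show ?case
    unfolding ideals_set_pow_Suc using nonprincipal_idempotent[OF assms(1)] by simp
qed simp

lemma pow_mem_M:
  assumes x: "x \<in> M" and k: "0 < (k::nat)"
  shows "x [^] k \<in> M"
  using k
proof (induction k)
  case (Suc k)
  then show ?case
    using x mult_mem_M(1)[of "x [^] k" x] M_subset_A A_subset by (cases "k = 0") auto
qed simp

text \<open>After cancelling \<open>t\<close>, the condition says that \<open>r/s\<close> maps
  \<open>J\<close> into itself. Such a multiplier \<open>u\<close> lies in \<open>A\<close>: for
  \<open>J = A\<close> apply it to \<open>1\<close>; for \<open>J = M\<close>, if \<open>u\<close>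
  were outside \<open>A\<close> then \<open>1/u\<close> would be in \<open>M\<close>, and so would
  \<open>u(1/u) = 1\<close>.\<close>

lemma colon_l_coset:
  assumes s: "s \<in> carrier R" "s \<noteq> \<zero>" and t: "t \<in> carrier R" "t \<noteq> \<zero>"
    and J: "J = A \<or> J = M"
  shows "{r \<in> carrier R. \<forall>x \<in> t <# J. r \<otimes> x \<in> (s \<otimes> t) <# J} = s <# A"
proof (intro equalityI subsetI)
  have Jc: "J \<subseteq> carrier R" using J A_subset M_subset_A by auto
  fix r assume "r \<in> {r \<in> carrier R. \<forall>x \<in> t <# J. r \<otimes> x \<in> (s \<otimes> t) <# J}"
  then have r: "r \<in> carrier R" and rx: "\<And>x. x \<in> t <# J \<Longrightarrow> r \<otimes> x \<in> (s \<otimes> t) <# J" by auto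
  note si = nonzero_inv_facts[OF s]
  have J_stable: "(inv s \<otimes> r) \<otimes> y \<in> J" if y: "y \<in> J" for y
  proof -
    have yc: "y \<in> carrier R" using y Jc by auto
    have "t \<otimes> y \<in> t <# J" using y by (auto simp: l_coset_def)
    then obtain z where z: "z \<in> J" "r \<otimes> (t \<otimes> y) = (s \<otimes> t) \<otimes> z"
      using rx by (fastforce simp: l_coset_def)
    have zc: "z \<in> carrier R" using z Jc by auto
    have "t \<otimes> (r \<otimes> y) = t \<otimes> (s \<otimes> z)" using z(2) s t r yc zc by (simp add: m_ac)
    then have "r \<otimes> y = s \<otimes> z" using s t r yc zc by (simp add: m_lcancel)
    then have "(inv s \<otimes> r) \<otimes> y = (inv s \<otimes> s) \<otimes> z"
      using si(1) s(1) r yc zc by (simp add: m_assoc)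
    then show ?thesis using si zc z by simp
  qed
  have "inv s \<otimes> r \<in> A"
  proof (rule ccontr)
    assume n: "inv s \<otimes> r \<notin> A"
    have c: "inv s \<otimes> r \<in> carrier R" using si r by simp
    from J show False
    proof
      assume "J = A"
      then show False using J_stable[of \<one>] one_mem_A n c by simp
    next
      assume "J = M"
      then have "(inv s \<otimes> r) \<otimes> inv (inv s \<otimes> r) \<in> M"
        using J_stable not_mem_A_inv[OF c n] by simp
      then show False
        using nonzero_inv_facts(4)[OF c not_mem_A_inv(1)[OF c n]] one_not_mem_M by simp
    qed
  qed
  then show "r \<in> s <# A" using r mem_l_coset_iff[OF s A_subset] by simp
next
  fix r assume "r \<in> s <# A"
  then obtain u where u: "u \<in> A" "r = s \<otimes> u" by (auto simp: l_coset_def)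
  have uc: "u \<in> carrier R" using u A_subset by auto
  have "r \<otimes> x \<in> (s \<otimes> t) <# J" if x: "x \<in> t <# J" for x
  proof -
    obtain y where y: "y \<in> J" "x = t \<otimes> y" using x by (auto simp: l_coset_def)
    have "u \<otimes> y \<in> J" using J y u mult_mem_M subringE(6)[OF subring] by auto
    moreover have "y \<in> carrier R" using y J A_subset M_subset_A by auto
    then have "r \<otimes> x = (s \<otimes> t) \<otimes> (u \<otimes> y)" using u y s t uc by (simp add: m_ac)
    ultimately show ?thesis by (auto simp: l_coset_def)
  qed
  then show "r \<in> {r \<in> carrier R. \<forall>x \<in> t <# J. r \<otimes> x \<in> (s \<otimes> t) <# J}"
    using u uc s by simp
qed

end

section \<open>The annihilator of \<open>aM\<close> modulo its \<open>n\<close>-th power\<close>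

theorem proposition3p21:
  fixes K :: "('a, 'b) ring_scheme" (structure)
    and v :: "'a \<Rightarrow> 'g::linordered_ab_group_add extended"
    and \<O>\<^sub>v \<M>\<^sub>v \<O> \<M> aM aO ann :: "'a set" and a :: 'a and n :: nat
  assumes "valued_field K v"
    and "\<O>\<^sub>v = valuation_ring_of K v"
    and "maximalideal \<M>\<^sub>v (K\<lparr>carrier := \<O>\<^sub>v\<rparr>)"
    and "2 \<le> n"
    and "a \<in> \<O>\<^sub>v"
    and "valuation_ring \<O> K"
    and "\<O>\<^sub>v \<subseteq> \<O>"
    and "maximalideal \<M> (K\<lparr>carrier := \<O>\<rparr>)"
    and "aM = a <#\<^bsub>K\<^esub> \<M>"
    and "aO = a <#\<^bsub>K\<^esub> \<O>"
    and "aM [^]\<^bsub>ideals_set (K\<lparr>carrier := \<O>\<rparr>)\<^esub> n \<noteq> aM"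
    and "ann = annihilator (K\<lparr>carrier := \<O>\<^sub>v\<rparr>)
           (quotient_module ((module_over_self K)\<lparr>carrier := aM\<rparr>)
             (aM [^]\<^bsub>ideals_set (K\<lparr>carrier := \<O>\<rparr>)\<^esub> n))"
  shows "(principal_in K \<O> \<M> \<longrightarrow> ann = aM [^]\<^bsub>ideals_set (K\<lparr>carrier := \<O>\<rparr>)\<^esub> (n - 1))
    \<and> (\<not> principal_in K \<O> \<M> \<longrightarrow>
         ann = aO [^]\<^bsub>ideals_set (K\<lparr>carrier := \<O>\<rparr>)\<^esub> (n - 1)
         \<and> aO [^]\<^bsub>ideals_set (K\<lparr>carrier := \<O>\<rparr>)\<^esub> (n - 1) = (a [^]\<^bsub>K\<^esub> (n - 1)) <#\<^bsub>K\<^esub> \<O>)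
    \<and> (ann = \<M>\<^sub>v \<longleftrightarrow>
         n = 2 \<and> a \<notin> \<M>\<^sub>v \<and> \<M> = \<M>\<^sub>v \<and> principal_in K \<O>\<^sub>v \<M>\<^sub>v)"
proof -
  interpret valued_field K v by fact
  interpret V: local_valuation_ring K "\<O>\<^sub>v" "\<M>\<^sub>v"
    using valuation_ring_valuation_ring_of assms(2,3)
    by (intro local_valuation_ring.intro local_valuation_ring_axioms.intro field_axioms) simp_all
  interpret O: local_valuation_ring K \<O> \<M>
    using assms(6,8)
    by (intro local_valuation_ring.intro local_valuation_ring_axioms.intro field_axioms)
  let ?S = "ideals_set (K\<lparr>carrier := \<O>\<rparr>)"
  interpret Oc: cring "K\<lparr>carrier := \<O>\<rparr>" by (rule O.cring_A)
  define m where "m = n - 1"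
  have n: "n = Suc m" and m: "0 < m" using assms(4) by (auto simp: m_def)
  have aO: "a \<in> \<O>" using assms(5,7) by blast
  then have a: "a \<in> carrier K" using O.A_subset by blast
  have VM: "\<M> \<subseteq> \<M>\<^sub>v"
    by (rule O.maximal_ideal_antimono[OF V.local_valuation_ring_axioms assms(7)])
  \<comment> \<open>Equal maximal ideals force equal rings, so principality over \<open>\<O>\<close>
    and over \<open>\<O>\<^sub>v\<close> can be exchanged.\<close>
  have eqO: "\<O>\<^sub>v = \<O>" if "\<M> = \<M>\<^sub>v"
    using O.ring_eq_of_maximal_ideal_eq[of "\<O>\<^sub>v"] V.local_valuation_ring_axioms assms(7) that by simp
  have O_ideal: "ideal \<O> (K\<lparr>carrier := \<O>\<rparr>)" using Oc.oneideal by simp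
  have aM_ideal: "ideal aM (K\<lparr>carrier := \<O>\<rparr>)"
    using Oc.ideal_l_coset[OF O.ideal_M, of a] aO assms(9) by (simp add: l_coset_def)
  have aM_sub: "aM \<subseteq> carrier K" using ideal.Icarr[OF aM_ideal] O.A_subset by auto
  have ann: "ann = \<O>\<^sub>v \<inter> {r \<in> carrier K. \<forall>x \<in> aM. r \<otimes> x \<in> aM [^]\<^bsub>?S\<^esub> n}"
    unfolding assms(12)
      annihilator_quotient_eq[OF V.subring O.subring assms(7) aM_sub Oc.ideals_set_pow_closed[OF aM_ideal]]
    using V.A_subset by blast
  \<comment> \<open>A zero scale factor would make \<open>aM\<close> equal to its
    \<open>n\<close>-th power; both cases use this to exclude zero.\<close>
  have pow_fixed: "t [^] n = t" if "t = \<zero>" for t using that by (simp add: n)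
  \<comment> \<open>Used with \<open>J = \<O>\<close>, \<open>t = ab\<close> in the principal case
    and \<open>J = \<M>\<close>, \<open>t = a\<close> in the other, with \<open>s\<close> the
    \<open>m\<close>-th power of \<open>t\<close>. Membership of \<open>s\<close> in
    \<open>\<M>\<close> keeps the whole colon inside \<open>\<O>\<^sub>v\<close>.\<close>
  have ann_colon: "ann = s <# \<O>"
    if J: "J = \<O> \<or> J = \<M>" and t: "t \<in> carrier K" "t \<noteq> \<zero>" and s: "s \<in> \<M>" "s \<noteq> \<zero>"
      and eq: "aM = t <# J" "aM [^]\<^bsub>?S\<^esub> n = (s \<otimes> t) <# J" for s t J
  proof -
    have "s <# \<O> \<subseteq> \<O>\<^sub>v"
      using O.l_coset_subset_M[OF s(1)] VM V.M_subset_A by blast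
    moreover have "s \<in> carrier K" using s O.M_subset_A O.A_subset by auto
    ultimately show ?thesis
      unfolding ann eq(2) unfolding eq(1) using O.colon_l_coset[OF _ s(2) t J] by blast
  qed

  show ?thesis
  proof (cases "principal_in K \<O> \<M>")
    case True
    then obtain b where b: "b \<in> carrier K" "\<M> = b <# \<O>" by (auto simp: principal_in_def)
    have "b \<otimes> \<one> \<in> b <# \<O>" using O.one_mem_A unfolding l_coset_def by blast
    then have bM: "b \<in> \<M>" using b by simp
    define t where "t = a \<otimes> b"
    have tM: "t \<in> \<M>" using O.mult_mem_M(2)[OF bM aO] by (simp add: t_def)
    have t: "t \<in> carrier K" using a b by (simp add: t_def)
    have aM: "aM = t <# \<O>"
      using l_coset_l_coset[OF O.A_subset a b(1)] assms(9) b(2) by (simp add: t_def)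
    have pow: "aM [^]\<^bsub>?S\<^esub> k = (t [^] k) <# \<O>" for k :: nat
      unfolding aM O.pow_l_coset[OF O_ideal t] O.A_pow ..
    have t0: "t \<noteq> \<zero>"
    proof
      assume "t = \<zero>"
      then have "t [^] n = t" by (rule pow_fixed)
      then have "aM [^]\<^bsub>?S\<^esub> n = aM" using pow[of n] aM by (simp only:)
      with assms(11) show False ..
    qed
    have "aM [^]\<^bsub>?S\<^esub> n = (t [^] m \<otimes> t) <# \<O>" unfolding pow n by simp
    then have ann_eq: "ann = (t [^] m) <# \<O>"
      using ann_colon[of \<O>, OF _ t t0 O.pow_mem_M[OF tM m] nonzero_pow[OF t t0] aM] by simp
    have "ann = \<M>\<^sub>v \<longleftrightarrow> n = 2 \<and> a \<notin> \<M>\<^sub>v \<and> \<M> = \<M>\<^sub>v \<and> principal_in K \<O>\<^sub>v \<M>\<^sub>v"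
    proof
      assume "ann = \<M>\<^sub>v"
      \<comment> \<open>The generator of \<open>ann\<close> lies in \<open>\<M>\<close>, so the
        assumed equality reverses the inclusion \<open>VM\<close>.\<close>
      moreover have "ann \<subseteq> \<M>"
        unfolding ann_eq by (rule O.l_coset_subset_M[OF O.pow_mem_M[OF tM m]])
      ultimately have M: "\<M> = \<M>\<^sub>v" using VM by blast
      have "b \<in> (t [^] m) <# \<O>" using bM M \<open>ann = \<M>\<^sub>v\<close> ann_eq by simp
      then obtain z where z: "z \<in> \<O>" "b = t [^] m \<otimes> z" unfolding l_coset_def by blast
      \<comment> \<open>Splitting off one factor \<open>t = ab\<close> exposes \<open>b\<close> on
        both sides of \<open>z(2)\<close>. Cancelling it leaves a product equal to \<open>1\<close>,
        in which a positive power of \<open>t\<close> is impossible.\<close>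
      obtain k where k: "m = Suc k" using m by (cases m) auto
      have zc: "z \<in> carrier K" using z O.A_subset by blast
      have b0: "b \<noteq> \<zero>" using t0 a by (auto simp: t_def)
      have "b \<otimes> \<one> = (t [^] k \<otimes> t) \<otimes> z" using z(2)[symmetric] b(1) unfolding k by simp
      also have "\<dots> = b \<otimes> (t [^] k \<otimes> (a \<otimes> z))"
        using a b(1) zc by (simp add: t_def m_ac)
      finally have one: "\<one> = t [^] k \<otimes> (a \<otimes> z)"
        using m_lcancel[OF b0 b(1), of \<one> "t [^] k \<otimes> (a \<otimes> z)"] a t zc by simp
      have k0: "k = 0"
      proof (rule ccontr)
        assume "k \<noteq> 0"
        then have "t [^] k \<otimes> (a \<otimes> z) \<in> \<M>"
          using O.pow_mem_M[OF tM] aO z(1) subringE(6)[OF O.subring] by (intro O.mult_mem_M(1)) auto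
        then show False using one O.one_not_mem_M by simp
      qed
      then have "a \<otimes> z = \<one>" using one a zc by simp
      then have "a \<notin> \<M>" using O.mult_mem_M(1)[of a z] z(1) O.one_not_mem_M by auto
      then show "n = 2 \<and> a \<notin> \<M>\<^sub>v \<and> \<M> = \<M>\<^sub>v \<and> principal_in K \<O>\<^sub>v \<M>\<^sub>v"
        using n k k0 M True eqO[OF M] by simp
    next
      assume r: "n = 2 \<and> a \<notin> \<M>\<^sub>v \<and> \<M> = \<M>\<^sub>v \<and> principal_in K \<O>\<^sub>v \<M>\<^sub>v"
      then have "m = 1" using n by simp
      then have "ann = aM" using ann_eq aM t by simp
      \<comment> \<open>Since \<open>a\<close> lies outside \<open>\<M>\<^sub>v = \<M>\<close>, it
        is a unit of \<open>\<O>\<close>.\<close>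
      also have "\<dots> = \<M>" using O.l_coset_unit[OF O.ideal_M aO] r assms(9) by simp
      finally show "ann = \<M>\<^sub>v" using r by simp
    qed
    then show ?thesis using True ann_eq pow[of m] by (simp add: m_def)
  next
    case False
    have pow: "aM [^]\<^bsub>?S\<^esub> k = (a [^] k) <# \<M>" if "0 < k" for k :: nat
      unfolding assms(9) O.pow_l_coset[OF O.ideal_M a] O.M_pow_nonprincipal[OF False that] ..
    have a0: "a \<noteq> \<zero>"
    proof
      assume "a = \<zero>"
      then have "a [^] n = a" by (rule pow_fixed)
      then have "aM [^]\<^bsub>?S\<^esub> n = aM" using pow[of n] assms(9) n by (simp only: zero_less_Suc)
      with assms(11) show False ..
    qed
    \<comment> \<open>Otherwise \<open>a\<close> is a unit of \<open>\<O>\<close>, so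
      \<open>aM\<close> is the idempotent \<open>\<M>\<close>, against the hypothesis on the
      \<open>n\<close>-th power.\<close>
    have aM: "a \<in> \<M>"
    proof (rule ccontr)
      assume "a \<notin> \<M>"
      then have "aM = \<M>" using O.l_coset_unit[OF O.ideal_M aO] assms(9) by simp
      then show False using assms(11) O.M_pow_nonprincipal[OF False, of n] n by simp
    qed
    have "aM [^]\<^bsub>?S\<^esub> n = (a [^] m \<otimes> a) <# \<M>" using pow[of n] unfolding n by simp
    then have ann_eq: "ann = (a [^] m) <# \<O>"
      using ann_colon[of \<M>, OF _ a a0 O.pow_mem_M[OF aM m] nonzero_pow[OF a a0] assms(9)] by simp
    have aO_pow: "aO [^]\<^bsub>?S\<^esub> m = (a [^] m) <# \<O>"
      unfolding assms(10) O.pow_l_coset[OF O_ideal a] O.A_pow ..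
    have "ann \<noteq> \<M>\<^sub>v"
    proof
      assume "ann = \<M>\<^sub>v"
      moreover have "ann \<subseteq> \<M>"
        unfolding ann_eq by (rule O.l_coset_subset_M[OF O.pow_mem_M[OF aM m]])
      \<comment> \<open>Squeezed between \<open>ann\<close> and \<open>\<M>\<^sub>v\<close>, the
        ideal \<open>\<M>\<close> would be principal.\<close>
      ultimately have "\<M> = (a [^] m) <# \<O>" using VM ann_eq by blast
      then show False using False a by (auto simp: principal_in_def)
    qed
    moreover have "\<not> (\<M> = \<M>\<^sub>v \<and> principal_in K \<O>\<^sub>v \<M>\<^sub>v)" using False eqO by auto
    ultimately show ?thesis using False ann_eq aO_pow by (auto simp: m_def)
  qed
qed

end
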